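(* Let $G$ be a full DAG, and let $M$ be the number of strands of $G$ that contain at least one edge incident to an inner vertex (i.e., all strands except single edges from a source to a sink). Then $G$ has exactly $2^M$ ample framings.
   Context: A DAG is a finite directed acyclic graph, possibly with multiple edges; sources have no incoming edges, sinks no outgoing edges, other vertices are inner; $\mathrm{in}(v),\mathrm{out}(v)$ denote incoming/outgoing edges. $G$ is full if every inner vertex $v$ has $|\mathrm{in}(v)|=|\mathrm{out}(v)|=2$. Strands: call two distinct edges $e,f$ linked if $\{e,f\}=\mathrm{in}(v)$ or $\{e,f\}=\mathrm{out}(v)$ for some inner vertex $v$. Each edge is linked to at most two others, and the connected components of the linking relation (the strands) form an edge-disjoint decomposition of $G$ into even cycles with alternating edge directions, alternating paths beginning and ending at sources or sinks, and single edges from a source to a sink. A route is a maximal directed path (source to sink). A framing assigns to each inner vertex $v$ a linear order $\prec$ on $\mathrm{in}(v)$ and one on $\mathrm{out}(v)$. For inner $v$, $\mathrm{In}(v)$/$\mathrm{Out}(v)$ are the directed paths from a source to $v$ / from $v$ to a sink; distinct $P,Q\in\mathrm{Out}(v)$ satisfy $P\prec Q$ iff at the last vertex $w$ of their common initial segment the edge of $P$ leaving $w$ precedes that of $Q$ in $\mathrm{out}(w)$; analogously for $\mathrm{In}(v)$ at the first vertex of the common final segment using $\mathrm{in}(w)$. For a route $R$ through $v$, $Rv$, $vR$ are its parts before and after $v$. Routes $P,Q$ through a common inner vertex $v$ are in conflict at $v$ if, after possibly swapping them, $Pv\prec Qv$ and $vQ\prec vP$; coherent if not in conflict at any common inner vertex.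 A route is exceptional if coherent with all routes. With $\mathcal{F}_+(G)\subset\mathbb{R}^{E(G)}$ the cone of nonnegative flows (conservation at inner vertices) and $v_R$ the indicator vector of $R$, a framing is ample if $\{v_R:R\text{ exceptional}\}$ lies in no facet of $\mathcal{F}_+(G)$ (equivalently, every non-idle edge lies on an exceptional route; an edge is idle if it is the only incoming or only outgoing edge of an inner vertex). *)

theory Defs
  imports "HOL-Analysis.Analysis" "Graph_Theory.Arc_Walk"
begin

definition dag :: "('v, 'e) pre_digraph \<Rightarrow> bool" where
  "dag G \<longleftrightarrow> fin_digraph G \<and> acyclic (arcs_ends G)"

definition sources :: "('v, 'e) pre_digraph \<Rightarrow> 'v set" where
  "sources G = {v \<in> verts G. in_arcs G v = {}}"

definition sinks :: "('v, 'e) pre_digraph \<Rightarrow> 'v set" where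
  "sinks G = {v \<in> verts G. out_arcs G v = {}}"

definition inner_verts :: "('v, 'e) pre_digraph \<Rightarrow> 'v set" where
  "inner_verts G = verts G - sources G - sinks G"

definition full_dag :: "('v, 'e) pre_digraph \<Rightarrow> bool" where
  "full_dag G \<longleftrightarrow> dag G \<and>
     (\<forall>v \<in> inner_verts G. in_degree G v = 2 \<and> out_degree G v = 2)"

definition linked :: "('v, 'e) pre_digraph \<Rightarrow> 'e rel" where
  "linked G = {(e, f). e \<noteq> f \<and>
     (\<exists>v \<in> inner_verts G. {e, f} = in_arcs G v \<or> {e, f} = out_arcs G v)}"

text \<open>Linking is symmetric, so the connected components are the classes of its
  reflexive-transitive closure.\<close>

definition strands :: "('v, 'e) pre_digraph \<Rightarrow> 'e set set" where
  "strands G = arcs G // (linked G)\<^sup>*"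

definition num_inner_strands :: "('v, 'e) pre_digraph \<Rightarrow> nat" where
  "num_inner_strands G =
     card {S \<in> strands G. \<exists>e \<in> S. tail G e \<in> inner_verts G \<or> head G e \<in> inner_verts G}"

text \<open>A framing is a pair of families of (reflexive) linear orders on the incoming and on the
  outgoing edges. Extensionality outside the inner vertices makes distinct elements of this
  set distinct as framings.\<close>

type_synonym ('v, 'e) framing = "('v \<Rightarrow> 'e rel) \<times> ('v \<Rightarrow> 'e rel)"

definition framings :: "('v, 'e) pre_digraph \<Rightarrow> ('v, 'e) framing set" where
  "framings G =
     (\<Pi>\<^sub>E v \<in> inner_verts G. {r. linear_order_on (in_arcs G v) r}) \<times>
     (\<Pi>\<^sub>E v \<in> inner_verts G. {r. linear_order_on (out_arcs G v) r})"

definition routes :: "('v, 'e) pre_digraph \<Rightarrow> 'e list set" where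
  "routes G = {R. \<exists>u \<in> sources G. \<exists>w \<in> sinks G. pre_digraph.awalk G u R w}"

definition route_through :: "('v, 'e) pre_digraph \<Rightarrow> 'e list \<Rightarrow> 'v \<Rightarrow> bool" where
  "route_through G R v \<longleftrightarrow> (\<exists>e \<in> set R. tail G e = v \<or> head G e = v)"

text \<open>For a route \<open>R\<close> through an inner vertex \<open>v\<close>, the edge leaving \<open>v\<close> is the unique edge
  of \<open>R\<close> with tail \<open>v\<close>; \<open>before\<close> and \<open>after\<close> split \<open>R\<close> in front of it.\<close>

definition before :: "('v, 'e) pre_digraph \<Rightarrow> 'e list \<Rightarrow> 'v \<Rightarrow> 'e list" where
  "before G R v = takeWhile (\<lambda>e. tail G e \<noteq> v) R"

definition after :: "('v, 'e) pre_digraph \<Rightarrow> 'v \<Rightarrow> 'e list \<Rightarrow> 'e list" where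
  "after G v R = dropWhile (\<lambda>e. tail G e \<noteq> v) R"

text \<open>\<open>in_less\<close> compares two paths from sources to the same inner vertex, \<open>out_less\<close> two paths
  from the same inner vertex to sinks. The list \<open>S\<close> is the common final (initial) segment.\<close>

definition in_less ::
    "('v, 'e) pre_digraph \<Rightarrow> ('v, 'e) framing \<Rightarrow> 'e list \<Rightarrow> 'e list \<Rightarrow> bool" where
  "in_less G F P Q \<longleftrightarrow> (\<exists>P' Q' S e f. P = P' @ e # S \<and> Q = Q' @ f # S \<and>
     e \<noteq> f \<and> (e, f) \<in> fst F (head G e))"

definition out_less ::
    "('v, 'e) pre_digraph \<Rightarrow> ('v, 'e) framing \<Rightarrow> 'e list \<Rightarrow> 'e list \<Rightarrow> bool" where
  "out_less G F P Q \<longleftrightarrow> (\<exists>P' Q' S e f. P = S @ e # P' \<and> Q = S @ f # Q' \<and>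
     e \<noteq> f \<and> (e, f) \<in> snd F (tail G e))"

definition conflict_at ::
    "('v, 'e) pre_digraph \<Rightarrow> ('v, 'e) framing \<Rightarrow> 'v \<Rightarrow> 'e list \<Rightarrow> 'e list \<Rightarrow> bool" where
  "conflict_at G F v P Q \<longleftrightarrow>
     in_less G F (before G P v) (before G Q v) \<and> out_less G F (after G v Q) (after G v P) \<or>
     in_less G F (before G Q v) (before G P v) \<and> out_less G F (after G v P) (after G v Q)"

definition coherent ::
    "('v, 'e) pre_digraph \<Rightarrow> ('v, 'e) framing \<Rightarrow> 'e list \<Rightarrow> 'e list \<Rightarrow> bool" where
  "coherent G F P Q \<longleftrightarrow> (\<forall>v \<in> inner_verts G.
     route_through G P v \<and> route_through G Q v \<longrightarrow> \<not> conflict_at G F v P Q)"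

definition exceptional_routes ::
    "('v, 'e) pre_digraph \<Rightarrow> ('v, 'e) framing \<Rightarrow> 'e list set" where
  "exceptional_routes G F = {R \<in> routes G. \<forall>Q \<in> routes G. coherent G F R Q}"

text \<open>The edge set is an arbitrary subset of a finite type \<open>'e\<close>, and the space of real
  functions on the edges is the coordinate subspace of \<open>real ^ 'e\<close> of vectors vanishing
  outside \<open>arcs G\<close>.\<close>

definition flow_cone :: "('v, 'e::finite) pre_digraph \<Rightarrow> (real ^ 'e) set" where
  "flow_cone G = {x. (\<forall>e. e \<notin> arcs G \<longrightarrow> x $ e = 0) \<and> (\<forall>e \<in> arcs G. 0 \<le> x $ e) \<and>
     (\<forall>v \<in> inner_verts G. (\<Sum>e \<in> in_arcs G v. x $ e) = (\<Sum>e \<in> out_arcs G v. x $ e))}"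

definition route_vector :: "'e list \<Rightarrow> real ^ 'e::finite" where
  "route_vector R = (\<chi> e. if e \<in> set R then 1 else 0)"

definition ample :: "('v, 'e::finite) pre_digraph \<Rightarrow> ('v, 'e) framing \<Rightarrow> bool" where
  "ample G F \<longleftrightarrow>
     \<not> (\<exists>K. K facet_of flow_cone G \<and> route_vector ` exceptional_routes G F \<subseteq> K)"

end

theory Submission
  imports Defs
begin

text \<open>At an inner vertex of a full DAG, a framing calls one incoming and one outgoing edge upper and
  the others lower, so that every edge is labelled at each of its inner ends. A route all of whose
  labels agree is extremal in every comparison, hence exceptional. Conversely, if two labels on a
  route differ, then a detour at the two places concerned conflicts with it. Since a framing is ample
  iff every edge lies on an exceptional route, it is ample iff the two labels of every edge with
  inner ends agree, that is, iff the labels form a proper two-colouring of the linking graph. That graph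
  is a union of two matchings, hence bipartite, so there are two such colourings per strand.\<close>

section \<open>Two-colourings of unions of two matchings\<close>

text \<open>Fixed points of the involutions represent unmatched elements. The induction removes a pair
  \<open>a\<close>, \<open>b = h a\<close> and matches \<open>t a\<close> with \<open>t b\<close> instead, which forces opposite colours on \<open>a\<close>, \<open>b\<close>.\<close>

lemma two_involutions_colouring:
  fixes h t :: "'a \<Rightarrow> 'a"
  assumes "finite E"
    and "\<And>x. x \<in> E \<Longrightarrow> h x \<in> E" "\<And>x. x \<in> E \<Longrightarrow> h (h x) = x"
    and "\<And>x. x \<in> E \<Longrightarrow> t x \<in> E" "\<And>x. x \<in> E \<Longrightarrow> t (t x) = x"
  shows "\<exists>c :: 'a \<Rightarrow> bool. \<forall>x\<in>E. (h x \<noteq> x \<longrightarrow> c (h x) \<noteq> c x) \<and> (t x \<noteq> x \<longrightarrow> c (t x) \<noteq> c x)"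
  using assms
proof (induction "card E" arbitrary: E t rule: less_induct)
  case less
  note fin = less.prems(1) and hE = less.prems(2) and hh = less.prems(3)
    and tE = less.prems(4) and tt = less.prems(5)
  show ?case
  proof (cases "E = {}")
    case True
    then show ?thesis by simp
  next
    case False
    then obtain a where a: "a \<in> E" by blast
    define b where "b = h a"
    define E' where "E' = E - {a, b}"
    have b: "b \<in> E" "h b = a" using a hE hh by (auto simp: b_def)
    \<comment> \<open>If only one of \<open>t a\<close>, \<open>t b\<close> lies in
      \<open>E'\<close>, or if \<open>a = b\<close>, the survivor becomes a fixed point of
      \<open>t'\<close> and loses its \<open>t\<close>-constraint.\<close>
    define t' where "t' = (\<lambda>x. if t x = a then (if t b \<in> E' then t b else x)
      else if t x = b then (if t a \<in> E' then t a else x) else t x)"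
    have card: "card E' < card E"
      unfolding E'_def using a fin by (intro psubset_card_mono) auto
    have E': "x \<in> E' \<longleftrightarrow> x \<in> E \<and> x \<noteq> a \<and> x \<noteq> b" for x by (auto simp: E'_def)
    have h': "h x \<in> E'" if "x \<in> E'" for x
      using that hE[of x] hh[of x] b by (auto simp: E'_def b_def)
    have t': "t' x \<in> E' \<and> t' (t' x) = x" if x: "x \<in> E'" for x
    proof -
      consider "t x = a" | "t x = b" "t x \<noteq> a" | "t x \<noteq> a" "t x \<noteq> b" by blast
      then show ?thesis
      proof cases
        case 1
        then have "t a = x" using x tt[of x] by (simp add: E')
        then show ?thesis using 1 x tt[OF b(1)] by (auto simp: t'_def)
      next
        case 2
        then have "t b = x" using x tt[of x] by (simp add: E')
        then show ?thesis using 2 x tt[OF a] by (auto simp: t'_def)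
      next
        case 3
        then show ?thesis using x tE[of x] tt[of x] by (auto simp: t'_def E')
      qed
    qed
    have finE': "finite E'" using fin by (simp add: E'_def)
    have hh': "h (h x) = x" if "x \<in> E'" for x using that hh[of x] by (simp add: E')
    have "\<exists>c :: 'a \<Rightarrow> bool. \<forall>x\<in>E'. (h x \<noteq> x \<longrightarrow> c (h x) \<noteq> c x) \<and> (t' x \<noteq> x \<longrightarrow> c (t' x) \<noteq> c x)"
      using t' by (intro less.hyps[OF card finE' h' hh']) blast+
    then obtain c :: "'a \<Rightarrow> bool" where
      c: "\<And>x. x \<in> E' \<Longrightarrow> (h x \<noteq> x \<longrightarrow> c (h x) \<noteq> c x) \<and> (t' x \<noteq> x \<longrightarrow> c (t' x) \<noteq> c x)"
      by blast
    \<comment> \<open>\<open>ca\<close> avoids the colour of \<open>t a\<close>. If only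
      \<open>t b\<close> is left, it copies the colour of \<open>t b\<close>, so that its negation
      \<open>cb\<close> avoids that colour. The default \<open>True\<close> is arbitrary.\<close>
    define ca where "ca = (if t a \<in> E' then \<not> c (t a) else if t b \<in> E' then c (t b) else True)"
    define cb where "cb = (if a = b then ca else \<not> ca)"
    have cab: "cb \<noteq> ca" if "a \<noteq> b" using that by (simp add: cb_def)
    have ca: "ca \<noteq> c (t a)" if "t a \<in> E'"
      using that by (simp add: ca_def)
    have cb: "cb \<noteq> c (t b)" if tb: "t b \<in> E'"
    proof (cases "t a \<in> E' \<and> a \<noteq> b")
      \<comment> \<open>The new pair is used here: \<open>t'\<close> joins \<open>t a\<close> to
        \<open>t b\<close>, so these differ in colour, and \<open>cb\<close>, being equal to
        \<open>c (t a)\<close>, avoids \<open>c (t b)\<close>.\<close>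
      case True
      then have "t' (t a) = t b" "t b \<noteq> t a" using tb tt[OF a] tt[OF b(1)] by (auto simp: t'_def)
      then have "c (t b) \<noteq> c (t a)" using c[of "t a"] True by metis
      moreover have "cb = c (t a)" using True by (simp add: cb_def ca_def)
      ultimately show ?thesis by blast
    next
      case False
      then consider "a = b" | "a \<noteq> b" "t a \<notin> E'" by blast
      then show ?thesis by cases (use tb ca in \<open>simp_all add: cb_def ca_def\<close>)
    qed
    define c' where "c' = c(a := ca, b := cb)"
    have c'ab: "c' a = ca" "c' b = cb" by (auto simp: c'_def cb_def)
    have c': "c' x = c x" if "x \<in> E'" for x using that by (auto simp: c'_def E')
    have "(h x \<noteq> x \<longrightarrow> c' (h x) \<noteq> c' x)" if x: "x \<in> E" for x
    proof (cases "x \<in> E'")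
      case True
      then show ?thesis using c[OF True] h'[OF True] c'[OF True] c'[OF h'[OF True]] by simp
    next
      case False
      then have "x = a \<or> x = b" using x by (auto simp: E')
      moreover have "h a = b" by (simp add: b_def)
      ultimately show ?thesis using b(2) c'ab cab by metis
    qed
    moreover have "t x \<noteq> x \<longrightarrow> c' (t x) \<noteq> c' x" if x: "x \<in> E" for x
    proof (cases "x \<in> E'")
      case True
      consider "t x = a" | "t x = b" | "t x \<in> E'" using tE[OF x] by (auto simp: E')
      then show ?thesis
      proof cases
        case 1
        then have "t a = x" using tt[OF x] by simp
        then show ?thesis using 1 True ca by (simp add: c'ab c')
      next
        case 2
        then have "t b = x" using tt[OF x] by simp
        then show ?thesis using 2 True cb by (simp add: c'ab c')
      next
        case 3
        then have "t' x = t x" by (auto simp: t'_def E')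
        then show ?thesis using c[OF True] c'[OF True] c'[OF 3] by simp
      qed
    next
      case False
      then have "x = a \<or> x = b" using x by (auto simp: E')
      then show ?thesis
      proof
        assume xa: "x = a"
        show ?thesis
        proof (cases "t a \<in> E'")
          case True
          then show ?thesis using ca by (simp add: xa c'ab c')
        next
          case False
          then have "t a = a \<or> t a = b" using tE[OF a] by (auto simp: E')
          then show ?thesis using xa c'ab cab by metis
        qed
      next
        assume xa: "x = b"
        show ?thesis
        proof (cases "t b \<in> E'")
          case True
          then show ?thesis using cb by (simp add: xa c'ab c')
        next
          case False
          then have "t b = a \<or> t b = b" using tE[OF b(1)] by (auto simp: E')
          then show ?thesis using xa c'ab cab by metis
        qed
      qed
    qed
    ultimately show ?thesis by blast
  qed
qed

section \<open>Ample framings and exceptional routes\<close>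

text \<open>Polyhedrality matters because a proper face of a general convex cone need not lie in a
  facet. Each edge contributes a half-space; each coordinate outside \<open>arcs G\<close> and each
  conservation law contributes a hyperplane.\<close>

lemma polyhedron_flow_cone:
  fixes G :: "('v, 'e::finite) pre_digraph"
  assumes "finite (verts G)"
  shows "polyhedron (flow_cone G)"
proof -
  define A where "A = (\<lambda>e::'e. if e \<in> arcs G then {x::real^'e. axis e 1 \<bullet> x \<ge> 0} else {x. axis e 1 \<bullet> x = 0})"
  define B where "B = (\<lambda>v. {x::real^'e. ((\<Sum>e\<in>in_arcs G v. axis e 1) - (\<Sum>e\<in>out_arcs G v. axis e 1)) \<bullet> x = 0})"
  have "flow_cone G = \<Inter> (range A) \<inter> \<Inter> (B ` inner_verts G)"
    by (auto simp: flow_cone_def A_def B_def inner_axis' inner_diff_left inner_sum_left split: if_splits)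
  moreover have "polyhedron (A e)" for e
    by (auto simp: A_def polyhedron_halfspace_ge polyhedron_hyperplane)
  moreover have "polyhedron (B v)" for v
    by (auto simp: B_def polyhedron_hyperplane)
  moreover have "finite (inner_verts G)"
    using assms by (simp add: inner_verts_def)
  ultimately show ?thesis
    by (auto intro!: polyhedron_Int polyhedron_Inter)
qed

text \<open>A flow that is positive on every edge is a relative interior point: from any
  \<open>y\<close> in the cone the segment to \<open>x\<close> can be prolonged beyond
  \<open>x\<close>, and a face containing \<open>x\<close> then contains \<open>y\<close>.\<close>

lemma face_of_containing_positive_flow:
  fixes G :: "('v, 'e::finite) pre_digraph"
  assumes K: "K face_of flow_cone G" and x: "x \<in> K" and pos: "\<And>e. e \<in> arcs G \<Longrightarrow> x $ e > 0"
  shows "K = flow_cone G"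
proof
  show "K \<subseteq> flow_cone G" using K by (rule face_of_imp_subset)
  have xC: "x \<in> flow_cone G" using K x face_of_imp_subset by blast
  show "flow_cone G \<subseteq> K"
  proof
    fix y assume y: "y \<in> flow_cone G"
    show "y \<in> K"
    proof (cases "y = x")
      case False
      \<comment> \<open>The step length keeps \<open>m * y\<close> below \<open>x\<close> on every
        edge. Adding 1 makes the denominators positive, and inserting 1 makes the set
        nonempty.\<close>
      define m where "m = Min (insert 1 ((\<lambda>e. x $ e / (1 + y $ e)) ` arcs G))"
      have ynn: "y $ e \<ge> 0" if "e \<in> arcs G" for e using y that by (auto simp: flow_cone_def)
      have m0: "m > 0" unfolding m_def using pos ynn
        by (subst Min_gr_iff) (auto intro!: divide_pos_pos add_pos_nonneg)
      have m: "m * y $ e \<le> x $ e" if "e \<in> arcs G" for e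
      proof -
        have "m \<le> x $ e / (1 + y $ e)" unfolding m_def using that by (intro Min_le) auto
        then have "m * (1 + y $ e) \<le> x $ e" using ynn[OF that] by (simp add: field_simps)
        then show ?thesis using m0 by (simp add: algebra_simps)
      qed
      define z where "z = x + m *\<^sub>R (x - y)"
      have "z \<in> flow_cone G"
        unfolding flow_cone_def
      proof (intro CollectI conjI allI ballI impI)
        show "z $ e = 0" if "e \<notin> arcs G" for e
          using that xC y by (simp add: z_def flow_cone_def)
        show "0 \<le> z $ e" if "e \<in> arcs G" for e
          using add_mono[OF m[OF that] less_imp_le[OF mult_pos_pos[OF m0 pos[OF that]]]]
          by (simp add: z_def algebra_simps)
        show "(\<Sum>e\<in>in_arcs G v. z $ e) = (\<Sum>e\<in>out_arcs G v. z $ e)" if "v \<in> inner_verts G" for v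
          using that xC y
          by (simp add: z_def flow_cone_def sum.distrib sum_subtractf flip: sum_distrib_left)
      qed
      \<comment> \<open>Solving the definition of \<open>z\<close> for \<open>x\<close> gives the
        weights \<open>m / (1 + m)\<close> on \<open>y\<close> and \<open>1 / (1 + m)\<close> on
        \<open>z\<close>.\<close>
      moreover have "x \<in> open_segment y z"
        unfolding in_segment
      proof (intro conjI exI[of _ "1 / (1 + m)"])
        show "y \<noteq> z"
        proof
          assume "y = z"
          then have "(1 + m) *\<^sub>R (x - y) = 0" by (simp add: z_def algebra_simps)
          then show False using False m0 by simp
        qed
        have u: "1 / (1 + m) + 1 / (1 + m) * m = 1" using m0 by (simp add: field_simps)
        have "(1 - 1 / (1 + m)) *\<^sub>R y + (1 / (1 + m)) *\<^sub>R z =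
          (1 - (1 / (1 + m) + 1 / (1 + m) * m)) *\<^sub>R y + (1 / (1 + m) + 1 / (1 + m) * m) *\<^sub>R x"
          unfolding z_def by (simp only: algebra_simps scaleR_scaleR)
        then show "x = (1 - 1 / (1 + m)) *\<^sub>R y + (1 / (1 + m)) *\<^sub>R z"
          unfolding u by simp
      qed (use m0 in auto)
      ultimately show ?thesis using K x y unfolding face_of_def by blast
    qed (use x in simp)
  qed
qed

section \<open>Walks, routes and route vectors in finite acyclic digraphs\<close>

locale dag_graph = fin_digraph G for G :: "('v, 'e::finite) pre_digraph" +
  assumes acyclic_arcs: "acyclic (arcs_ends G)"
begin

lemma inner_verts_iff: "v \<in> inner_verts G \<longleftrightarrow> in_arcs G v \<noteq> {} \<and> out_arcs G v \<noteq> {}"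
  by (auto simp: inner_verts_def sources_def sinks_def)

text \<open>Otherwise the part of the walk from \<open>x\<close> up to \<open>e\<close> would be a
  directed cycle. Hence a walk repeats no edge, and splitting a route at a vertex is
  unambiguous.\<close>

lemma awalk_tail_neq:
  assumes "awalk u (p @ e # q) w" "x \<in> set p"
  shows "tail G x \<noteq> tail G e"
proof
  assume eq: "tail G x = tail G e"
  obtain p1 p2 where "p = p1 @ x # p2" using assms(2) by (meson split_list)
  then have "awalk (tail G x) (x # p2) (tail G e)"
    using assms(1) by (auto simp: awalk_simps)
  then have "tail G x \<rightarrow>\<^sup>+\<^bsub>G\<^esub> tail G e" by (auto simp: reachable1_awalk)
  then show False using acyclic_arcs eq by (auto simp: acyclic_def)
qed

lemma before_after_split:
  assumes "awalk u (p @ e # q) w"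
  shows "before G (p @ e # q) (tail G e) = p" "after G (tail G e) (p @ e # q) = e # q"
proof -
  have "\<And>x. x \<in> set p \<Longrightarrow> tail G x \<noteq> tail G e" using awalk_tail_neq[OF assms] .
  then show "before G (p @ e # q) (tail G e) = p" "after G (tail G e) (p @ e # q) = e # q"
    by (auto simp: before_def after_def takeWhile_append dropWhile_append)
qed

lemma head_inner_of_awalk:
  assumes "awalk u (p @ e # q) w" "q \<noteq> []"
  shows "head G e \<in> inner_verts G"
  using assms by (cases q) (auto simp: awalk_simps inner_verts_iff)

lemma tail_inner_of_awalk:
  assumes "awalk u (p @ e # q) w" "p \<noteq> []"
  shows "tail G e \<in> inner_verts G"
  using assms by (cases p rule: rev_cases) (auto simp: awalk_simps inner_verts_iff)

text \<open>Edges satisfying \<open>A\<close> are followed greedily until acyclicity stops the walk.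
  Nonemptiness of \<open>in_arcs G v\<close> is the invariant: a vertex reached by an edge is a sink
  or inner, and in the latter case \<open>ext\<close> supplies the next edge.\<close>

lemma awalk_to_sink:
  assumes ext: "\<And>v. v \<in> inner_verts G \<Longrightarrow> \<exists>x\<in>out_arcs G v. A x"
    and "in_arcs G v \<noteq> {}"
  shows "\<exists>p. \<exists>w\<in>sinks G. awalk v p w \<and> (\<forall>x\<in>set p. A x)"
proof -
  have "wf ((arcs_ends G)\<inverse>)"
    using acyclic_arcs by (intro finite_acyclic_wf_converse) (auto simp: arcs_ends_def)
  then show ?thesis using assms(2)
  proof (induction v rule: wf_induct_rule)
    case (less v)
    have v: "v \<in> verts G" using less.prems by auto
    show ?case
    proof (cases "out_arcs G v = {}")
      case True
      then show ?thesis using v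
        by (intro exI[of _ "[]"] bexI[of _ v]) (auto simp: sinks_def awalk_simps)
    next
      case False
      then obtain x where x: "x \<in> arcs G" "tail G x = v" "A x"
        using ext[of v] less.prems unfolding inner_verts_iff by fastforce
      then have "(head G x, v) \<in> (arcs_ends G)\<inverse>" by (auto simp: arcs_ends_conv)
      moreover have "in_arcs G (head G x) \<noteq> {}" using x by auto
      ultimately obtain p w where "w \<in> sinks G" "awalk (head G x) p w" "\<forall>x\<in>set p. A x"
        using less.IH by blast
      then show ?thesis using x
        by (intro exI[of _ "x # p"] bexI[of _ w]) (auto simp: awalk_simps)
    qed
  qed
qed

lemma awalk_from_source:
  assumes ext: "\<And>v. v \<in> inner_verts G \<Longrightarrow> \<exists>x\<in>in_arcs G v. A x"
    and "out_arcs G v \<noteq> {}"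
  shows "\<exists>p. \<exists>u\<in>sources G. awalk u p v \<and> (\<forall>x\<in>set p. A x)"
proof -
  have "wf (arcs_ends G)"
    using acyclic_arcs by (intro finite_acyclic_wf) (auto simp: arcs_ends_def)
  then show ?thesis using assms(2)
  proof (induction v rule: wf_induct_rule)
    case (less v)
    have v: "v \<in> verts G" using less.prems by auto
    show ?case
    proof (cases "in_arcs G v = {}")
      case True
      then show ?thesis using v
        by (intro exI[of _ "[]"] bexI[of _ v]) (auto simp: sources_def awalk_simps)
    next
      case False
      then obtain x where x: "x \<in> arcs G" "head G x = v" "A x"
        using ext[of v] less.prems unfolding inner_verts_iff by fastforce
      then have "(tail G x, v) \<in> arcs_ends G" by (auto simp: arcs_ends_conv)
      moreover have "out_arcs G (tail G x) \<noteq> {}" using x by auto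
      ultimately obtain p u where p: "u \<in> sources G" "awalk u p (tail G x)" "\<forall>x\<in>set p. A x"
        using less.IH by blast
      then have "awalk u (p @ [x]) v"
        using x by (intro awalk_appendI[of u p "tail G x"]) (auto simp: awalk_simps)
      then show ?thesis using p x
        by (intro exI[of _ "p @ [x]"] bexI[of _ u]) auto
    qed
  qed
qed

text \<open>The predicate \<open>A\<close> will say that an edge has a prescribed colour; this is
  how monochromatic routes are built.\<close>

lemma awalk_extends_to_route:
  assumes out: "\<And>v. v \<in> inner_verts G \<Longrightarrow> \<exists>x\<in>out_arcs G v. A x"
    and inn: "\<And>v. v \<in> inner_verts G \<Longrightarrow> \<exists>x\<in>in_arcs G v. A x"
    and S: "awalk u S w" "S \<noteq> []"
  shows "\<exists>P T. P @ S @ T \<in> routes G \<and> (\<forall>x\<in>set P \<union> set T. A x)"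
proof -
  have "out_arcs G u \<noteq> {}" using S by (cases S) (auto simp: awalk_simps)
  moreover have "in_arcs G w \<noteq> {}" using S by (cases S rule: rev_cases) (auto simp: awalk_simps)
  ultimately obtain P a T b where "a \<in> sources G" "awalk a P u" "b \<in> sinks G" "awalk w T b"
    "\<forall>x\<in>set P. A x" "\<forall>x\<in>set T. A x"
    using awalk_to_sink[of A w] awalk_from_source[of A u] out inn by metis
  moreover from this have "awalk a (P @ S @ T) b"
    using S by (blast intro: awalk_appendI)
  ultimately show ?thesis unfolding routes_def by blast
qed

lemma awalk_extends_to_some_route:
  assumes "awalk u S w" "S \<noteq> []"
  shows "\<exists>P T. P @ S @ T \<in> routes G"
proof -
  have "\<exists>P T. P @ S @ T \<in> routes G \<and> (\<forall>x\<in>set P \<union> set T. True)"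
    by (rule awalk_extends_to_route[OF _ _ assms]) (auto simp: inner_verts_iff)
  then show ?thesis by blast
qed

text \<open>The indicator of a walk can violate conservation only at its ends. With the two end
  terms added, the identity holds at every vertex and the induction can remove one edge at the
  front.\<close>

lemma awalk_flow_balance:
  assumes "awalk u p w"
  shows "(\<Sum>e\<in>in_arcs G v. route_vector p $ e) + (if u = v then 1 else 0) =
    (\<Sum>e\<in>out_arcs G v. route_vector p $ e) + (if w = v then 1 else 0)"
  using assms
proof (induction p arbitrary: u)
  case Nil
  then show ?case by (auto simp: route_vector_def awalk_simps)
next
  case (Cons e p)
  have "e \<notin> set p"
  proof
    assume "e \<in> set p"
    then obtain p1 p2 where "p = p1 @ e # p2" by (meson split_list)
    then have "awalk u ((e # p1) @ e # p2) w" using Cons.prems by simp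
    from awalk_tail_neq[OF this, of e] show False by simp
  qed
  then have "route_vector (e # p) $ x = (if x = e then 1 else 0) + route_vector p $ x" for x
    by (auto simp: route_vector_def)
  moreover have "e \<in> arcs G" "tail G e = u" "awalk (head G e) p w"
    using Cons.prems by (auto simp: awalk_simps)
  ultimately show ?case
    using Cons.IH[of "head G e"] by (auto simp: sum.distrib sum.delta)
qed

lemma route_vector_in_flow_cone:
  assumes "R \<in> routes G"
  shows "route_vector R \<in> flow_cone G"
proof -
  obtain u w where uw: "u \<in> sources G" "w \<in> sinks G" "awalk u R w"
    using assms by (auto simp: routes_def)
  have "(\<Sum>e\<in>in_arcs G v. route_vector R $ e) = (\<Sum>e\<in>out_arcs G v. route_vector R $ e)"
    if "v \<in> inner_verts G" for v
  proof -
    have "u \<noteq> v" "w \<noteq> v" using that uw by (auto simp: inner_verts_def)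
    then show ?thesis using awalk_flow_balance[OF uw(3), of v] by simp
  qed
  then show ?thesis using uw(3) by (auto simp: flow_cone_def route_vector_def)
qed

text \<open>If \<open>e\<close> lies on no exceptional route, the flows vanishing on
  \<open>e\<close> form a face containing all exceptional route vectors; a route through
  \<open>e\<close> shows that it is proper, so it lies in a facet. Conversely, averaging one
  exceptional route per edge gives a positive flow, which no facet contains.\<close>

lemma ample_iff: "ample G F \<longleftrightarrow> (\<forall>e\<in>arcs G. \<exists>R\<in>exceptional_routes G F. e \<in> set R)"
proof
  assume ample: "ample G F"
  show "\<forall>e\<in>arcs G. \<exists>R\<in>exceptional_routes G F. e \<in> set R"
  proof (rule ccontr)
    assume "\<not> ?thesis"
    then obtain e where e: "e \<in> arcs G" "\<And>R. R \<in> exceptional_routes G F \<Longrightarrow> e \<notin> set R" by blast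
    define K where "K = flow_cone G \<inter> {x. axis e 1 \<bullet> x = 0}"
    have poly: "polyhedron (flow_cone G)" by (rule polyhedron_flow_cone) simp
    have K: "K face_of flow_cone G" unfolding K_def
      using e(1) polyhedron_imp_convex[OF poly]
      by (intro face_of_Int_supporting_hyperplane_ge) (auto simp: inner_axis' flow_cone_def)
    have "0 \<in> K" by (auto simp: K_def flow_cone_def)
    then have "K \<noteq> {}" by blast
    obtain P T where "P @ [e] @ T \<in> routes G"
      using awalk_extends_to_some_route[OF arc_implies_awalk[OF e(1)]] by auto
    moreover have "route_vector (P @ [e] @ T) \<notin> K"
      by (simp add: K_def inner_axis' route_vector_def)
    ultimately have "route_vector (P @ [e] @ T) \<in> flow_cone G - K"
      using route_vector_in_flow_cone by blast
    then have "K \<noteq> flow_cone G" by blast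
    then obtain L where "L facet_of flow_cone G" "K \<subseteq> L"
      using face_of_polyhedron_subset_facet[OF poly K \<open>K \<noteq> {}\<close>] by blast
    moreover have "route_vector ` exceptional_routes G F \<subseteq> K"
    proof (rule image_subsetI)
      fix R assume R: "R \<in> exceptional_routes G F"
      then have "route_vector R \<in> flow_cone G"
        by (simp add: exceptional_routes_def route_vector_in_flow_cone)
      then show "route_vector R \<in> K"
        using e(2)[OF R] by (simp add: K_def inner_axis' route_vector_def)
    qed
    ultimately show False using ample unfolding ample_def by blast
  qed
next
  assume "\<forall>e\<in>arcs G. \<exists>R\<in>exceptional_routes G F. e \<in> set R"
  then obtain R where R: "\<And>e. e \<in> arcs G \<Longrightarrow> R e \<in> exceptional_routes G F \<and> e \<in> set (R e)"
    by metis
  show "ample G F"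
    unfolding ample_def
  proof
    assume "\<exists>K. K facet_of flow_cone G \<and> route_vector ` exceptional_routes G F \<subseteq> K"
    then obtain K where K: "K face_of flow_cone G" "K \<noteq> {}" "aff_dim K = aff_dim (flow_cone G) - 1"
      "route_vector ` exceptional_routes G F \<subseteq> K"
      by (auto simp: facet_of_def)
    obtain x where "x \<in> K" "\<And>e. e \<in> arcs G \<Longrightarrow> x $ e > 0"
    proof (cases "arcs G = {}")
      case True
      then show ?thesis using K(2) that by blast
    next
      case False
      define n where "n = card (arcs G)"
      have n: "n > 0" using False by (simp add: n_def card_gt_0_iff)
      define x where "x = (\<Sum>e\<in>arcs G. (1 / real n) *\<^sub>R route_vector (R e))"
      have "x \<in> K" unfolding x_def
        using K R n by (intro convex_sum face_of_imp_convex) (auto simp: n_def)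
      moreover have "x $ e > 0" if "e \<in> arcs G" for e
        unfolding x_def sum_component
        using that R[OF that] n by (intro sum_pos2[of _ e]) (auto simp: route_vector_def)
      ultimately show ?thesis using that by blast
    qed
    then have "K = flow_cone G" using face_of_containing_positive_flow K(1) by blast
    then show False using K(3) by simp
  qed
qed

text \<open>A detour of \<open>R\<close> through the other edges at both ends of the common segment \<open>S\<close> conflicts
  with \<open>R\<close> if the two orders disagree.\<close>

lemma exceptional_no_crossing:
  assumes R: "P @ d # S @ g # T \<in> exceptional_routes G F"
    and d': "d' \<in> in_arcs G (head G d)" "d' \<noteq> d"
    and g': "g' \<in> out_arcs G (tail G g)" "g' \<noteq> g"
  shows "\<not> ((d, d') \<in> fst F (head G d) \<and> (g', g) \<in> snd F (tail G g))"
    and "\<not> ((d', d) \<in> fst F (head G d) \<and> (g, g') \<in> snd F (tail G g))"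
proof -
  let ?R = "P @ d # S @ g # T" and ?v = "tail G g"
  obtain a b where ab: "awalk a ?R b"
    using R by (auto simp: exceptional_routes_def routes_def)
  then have "awalk (head G d) S ?v" "g \<in> arcs G" "d \<in> arcs G" by (auto simp: awalk_simps)
  then have "awalk (tail G d') (d' # S @ [g']) (head G g')"
    using d' g' by (auto simp: awalk_simps intro!: awalk_appendI)
  then obtain P' T' where "P' @ (d' # S @ [g']) @ T' \<in> routes G"
    using awalk_extends_to_some_route by blast
  then have Q: "P' @ d' # S @ g' # T' \<in> routes G" (is "?Q \<in> _") by simp
  then obtain a' b' where ab': "awalk a' ?Q b'" by (auto simp: routes_def)
  have tg': "tail G g' = ?v" and hd': "head G d' = head G d" using d' g' by auto
  have v: "?v \<in> inner_verts G"
    using tail_inner_of_awalk[of a "P @ d # S" g T b] ab by simp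
  \<comment> \<open>At \<open>?v\<close> the incoming parts share \<open>S\<close> and differ just
    before it in \<open>d\<close>, \<open>d'\<close>; the outgoing parts differ at once in
    \<open>g\<close>, \<open>g'\<close>. Thus only these two orders decide the conflict.\<close>
  have BA: "before G ?R ?v = P @ d # S" "after G ?v ?R = g # T"
    "before G ?Q ?v = P' @ d' # S" "after G ?v ?Q = g' # T'"
    using before_after_split[of a "P @ d # S" g T b] ab
      before_after_split[of a' "P' @ d' # S" g' T' b'] ab' tg' by simp_all
  have "\<not> conflict_at G F ?v ?R ?Q"
    using R Q v tg' unfolding exceptional_routes_def coherent_def route_through_def by force
  then have "\<not> (in_less G F (P @ d # S) (P' @ d' # S) \<and> out_less G F (g' # T') (g # T))"
    "\<not> (in_less G F (P' @ d' # S) (P @ d # S) \<and> out_less G F (g # T) (g' # T'))"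
    unfolding conflict_at_def BA by auto
  moreover have "in_less G F (P @ d # S) (P' @ d' # S)" if "(d, d') \<in> fst F (head G d)"
    using that d' unfolding in_less_def by blast
  moreover have "in_less G F (P' @ d' # S) (P @ d # S)" if "(d', d) \<in> fst F (head G d)"
    using that d'(2) hd' unfolding in_less_def by metis
  moreover have "out_less G F (g' # T') (g # T)" if "(g', g) \<in> snd F ?v"
    using that g'(2) tg' unfolding out_less_def by (metis append_Nil)
  moreover have "out_less G F (g # T) (g' # T')" if "(g, g') \<in> snd F ?v"
    using that g'(2) tg' unfolding out_less_def by (metis append_Nil)
  ultimately show "\<not> ((d, d') \<in> fst F (head G d) \<and> (g', g) \<in> snd F ?v)"
    "\<not> ((d', d) \<in> fst F (head G d) \<and> (g, g') \<in> snd F ?v)" by blast+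
qed

end

section \<open>Framings from edge colourings\<close>

text \<open>\<open>True\<close> stands for upper, \<open>False\<close> for lower. Distinct elements
  of equal colour are incomparable, so linearity calls for \<open>inj_on c A\<close>, which
  expresses that the edges on one side of a vertex differ in colour.\<close>

definition order_by :: "('a \<Rightarrow> bool) \<Rightarrow> 'a set \<Rightarrow> 'a rel" where
  "order_by c A = {(x, y). x \<in> A \<and> y \<in> A \<and> (x = y \<or> \<not> c x \<and> c y)}"

definition above_another :: "'a rel \<Rightarrow> 'a \<Rightarrow> bool" where
  "above_another r x \<longleftrightarrow> (\<exists>y. y \<noteq> x \<and> (y, x) \<in> r)"

lemma order_by_cong: "(\<And>x. x \<in> A \<Longrightarrow> c x = d x) \<Longrightarrow> order_by c A = order_by d A"
  by (auto simp: order_by_def)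

lemma inj_on_pair_bool:
  fixes c :: "'a \<Rightarrow> bool"
  assumes "y \<noteq> x"
  shows "inj_on c {x, y} \<longleftrightarrow> c y = (\<not> c x)"
  using assms by (cases "c x"; cases "c y") (auto simp: inj_on_def)

lemma linear_order_on_order_by:
  assumes "inj_on c A"
  shows "linear_order_on A (order_by c A)"
  using assms
  by (auto simp: order_by_def order_on_defs refl_on_def trans_def antisym_def total_on_def inj_on_def)

lemma card_2_other:
  assumes "card A = 2" "x \<in> A"
  obtains y where "A = {x, y}" "y \<noteq> x"
  using assms by (auto simp: card_2_iff)

text \<open>A linear order on two elements is determined by its upper element, which
  \<open>above_another\<close> detects. With \<open>above_another_order_by\<close> this makes labels
  and orders on a pair interchangeable.\<close>

lemma linear_order_on_card_2:
  assumes A: "card A = 2" and r: "linear_order_on A r"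
  shows "inj_on (above_another r) A" and "order_by (above_another r) A = r"
proof -
  obtain x y where xy: "A = {x, y}" "x \<noteq> y" using A by (auto simp: card_2_iff)
  have sub: "r \<subseteq> {x, y} \<times> {x, y}" and "(x, x) \<in> r" "(y, y) \<in> r"
    and asym: "\<not> ((x, y) \<in> r \<and> (y, x) \<in> r)" and tot: "(x, y) \<in> r \<or> (y, x) \<in> r"
    using r xy by (auto simp: order_on_defs refl_on_def antisym_def total_on_def)
  moreover from this have "r = (if (x, y) \<in> r then {(x, x), (y, y), (x, y)} else {(x, x), (y, y), (y, x)})"
    by auto
  moreover have "above_another r x \<longleftrightarrow> (y, x) \<in> r" "above_another r y \<longleftrightarrow> (x, y) \<in> r"
    using sub xy(2) by (auto simp: above_another_def)
  ultimately show "inj_on (above_another r) A" "order_by (above_another r) A = r"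
    unfolding order_by_def xy(1) using xy(2) by (auto simp: inj_on_def)
qed

lemma above_another_order_by:
  assumes A: "card A = 2" and c: "inj_on c A" and x: "x \<in> A"
  shows "above_another (order_by c A) x \<longleftrightarrow> c x"
proof -
  obtain y where "A = {x, y}" "y \<noteq> x" using card_2_other[OF A x] .
  moreover from this have "c y = (\<not> c x)" using c by (simp add: inj_on_pair_bool)
  ultimately show ?thesis by (auto simp: above_another_def order_by_def)
qed

text \<open>The restricted functions are \<open>undefined\<close> outside
  \<open>inner_verts G\<close>, matching the extensional products in
  \<open>framings\<close>.\<close>

definition colour_framing :: "('v, 'e) pre_digraph \<Rightarrow> ('e \<Rightarrow> bool) \<Rightarrow> ('v, 'e) framing" where
  "colour_framing G c =
     ((\<lambda>v\<in>inner_verts G. order_by c (in_arcs G v)), (\<lambda>v\<in>inner_verts G. order_by c (out_arcs G v)))"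

definition proper_colouring :: "('v, 'e) pre_digraph \<Rightarrow> ('e \<Rightarrow> bool) \<Rightarrow> bool" where
  "proper_colouring G c \<longleftrightarrow> (\<forall>(e, f) \<in> linked G. c e \<noteq> c f)"

context dag_graph
begin

text \<open>In a conflict, a route is lower on one side of the vertex and upper on the other. It
  then has an edge coloured \<open>False\<close> at one parting and one coloured \<open>True\<close>
  at the other, which is impossible for a single colour.\<close>

lemma monochromatic_route_exceptional:
  assumes R: "R \<in> routes G" and mono: "\<And>x. x \<in> set R \<Longrightarrow> c x = b"
  shows "R \<in> exceptional_routes G (colour_framing G c)"
proof -
  let ?F = "colour_framing G c"
  have in_lessD: "\<exists>e f. e \<in> set (before G X v) \<and> f \<in> set (before G Y v) \<and> \<not> c e \<and> c f"
    if X: "X \<in> routes G" and less: "in_less G ?F (before G X v) (before G Y v)"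
      and ne: "after G v X \<noteq> []" for X Y v
  proof -
    obtain P Q S e f where PQ: "before G X v = P @ e # S" "before G Y v = Q @ f # S"
      "e \<noteq> f" "(e, f) \<in> fst ?F (head G e)"
      using less unfolding in_less_def by blast
    have "X = P @ e # (S @ after G v X)"
      using PQ(1) takeWhile_dropWhile_id[of "\<lambda>e. tail G e \<noteq> v" X]
      unfolding before_def after_def by simp
    moreover obtain s t where "awalk s X t" using X by (auto simp: routes_def)
    ultimately have "awalk s (P @ e # (S @ after G v X)) t" by metis
    \<comment> \<open>As the route continues after \<open>e\<close>, the head of \<open>e\<close> is
      inner, so the order there is the one induced by \<open>c\<close>.\<close>
    then have "head G e \<in> inner_verts G" by (rule head_inner_of_awalk) (simp add: ne)
    then show ?thesis using PQ by (auto simp: colour_framing_def order_by_def)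
  qed
  have out_lessD: "\<exists>e f. e \<in> set (after G v X) \<and> f \<in> set (after G v Y) \<and> \<not> c e \<and> c f"
    if X: "X \<in> routes G" and less: "out_less G ?F (after G v X) (after G v Y)"
      and ne: "before G X v \<noteq> []" for X Y v
  proof -
    obtain P Q S e f where PQ: "after G v X = S @ e # P" "after G v Y = S @ f # Q"
      "e \<noteq> f" "(e, f) \<in> snd ?F (tail G e)"
      using less unfolding out_less_def by blast
    have "X = (before G X v @ S) @ e # P"
      using PQ(1) takeWhile_dropWhile_id[of "\<lambda>e. tail G e \<noteq> v" X]
      unfolding before_def after_def by simp
    moreover obtain s t where "awalk s X t" using X by (auto simp: routes_def)
    ultimately have "awalk s ((before G X v @ S) @ e # P) t" by metis
    then have "tail G e \<in> inner_verts G" by (rule tail_inner_of_awalk) (simp add: ne)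
    then show ?thesis using PQ by (auto simp: colour_framing_def order_by_def)
  qed
  have ne: "before G X v \<noteq> [] \<and> before G Y v \<noteq> []" if "in_less G ?F (before G X v) (before G Y v)" for X Y v
    using that unfolding in_less_def by auto
  have ne': "after G v X \<noteq> [] \<and> after G v Y \<noteq> []" if "out_less G ?F (after G v X) (after G v Y)" for X Y v
    using that unfolding out_less_def by auto
  have sub: "set (before G R v) \<subseteq> set R" "set (after G v R) \<subseteq> set R" for v
    by (auto simp: before_def after_def dest: set_takeWhileD set_dropWhileD)
  have "\<not> conflict_at G ?F v R Q" if Q: "Q \<in> routes G" for Q v
  proof
    assume "conflict_at G ?F v R Q"
    then consider
        "in_less G ?F (before G R v) (before G Q v)" "out_less G ?F (after G v Q) (after G v R)"
      | "in_less G ?F (before G Q v) (before G R v)" "out_less G ?F (after G v R) (after G v Q)"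
      unfolding conflict_at_def by blast
    then show False
    proof cases
      case 1
      then obtain e f where "e \<in> set (before G R v)" "\<not> c e" "f \<in> set (after G v R)" "c f"
        using in_lessD[OF R 1(1)] out_lessD[OF Q 1(2)] ne ne' by metis
      then show False using sub mono by blast
    next
      case 2
      then obtain e f where "e \<in> set (before G R v)" "c e" "f \<in> set (after G v R)" "\<not> c f"
        using in_lessD[OF Q 2(1)] out_lessD[OF R 2(2)] ne ne' by metis
      then show False using sub mono by blast
    qed
  qed
  then show ?thesis using R by (auto simp: exceptional_routes_def coherent_def)
qed

end

section \<open>Full DAGs: ample framings and proper colourings\<close>

locale full_dag_graph = dag_graph G for G :: "('v, 'e::finite) pre_digraph" +
  assumes card_in_arcs: "v \<in> inner_verts G \<Longrightarrow> card (in_arcs G v) = 2"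
    and card_out_arcs: "v \<in> inner_verts G \<Longrightarrow> card (out_arcs G v) = 2"
begin

lemma proper_colouring_iff:
  "proper_colouring G c \<longleftrightarrow>
    (\<forall>v\<in>inner_verts G. inj_on c (in_arcs G v) \<and> inj_on c (out_arcs G v))"
proof
  assume c: "proper_colouring G c"
  have *: "inj_on c A" if "card A = 2" "\<And>x y. {x, y} = A \<Longrightarrow> x \<noteq> y \<Longrightarrow> c x \<noteq> c y" for A
    using that by (metis card_2_iff inj_on_pair_bool)
  show "\<forall>v\<in>inner_verts G. inj_on c (in_arcs G v) \<and> inj_on c (out_arcs G v)"
    using c by (auto intro!: * card_in_arcs card_out_arcs simp: proper_colouring_def linked_def)
next
  assume *: "\<forall>v\<in>inner_verts G. inj_on c (in_arcs G v) \<and> inj_on c (out_arcs G v)"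
  have "c e \<noteq> c f" if "(e, f) \<in> linked G" for e f
  proof -
    obtain v where "f \<noteq> e" "v \<in> inner_verts G" "{e, f} = in_arcs G v \<or> {e, f} = out_arcs G v"
      using \<open>(e, f) \<in> linked G\<close> unfolding linked_def by blast
    moreover from this have "inj_on c {e, f}" using * by metis
    ultimately show ?thesis using inj_on_pair_bool[of f e c] by simp
  qed
  then show "proper_colouring G c" unfolding proper_colouring_def by blast
qed

lemma colour_framing_in_framings:
  "proper_colouring G c \<Longrightarrow> colour_framing G c \<in> framings G"
  by (auto simp: proper_colouring_iff colour_framing_def framings_def linear_order_on_order_by)

text \<open>Both colours occur among the incoming and among the outgoing edges of each inner vertex.
  Hence every edge extends both ways to a route of its own colour, which is exceptional.\<close>

lemma ample_colour_framing:
  assumes c: "proper_colouring G c"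
  shows "ample G (colour_framing G c)"
  unfolding ample_iff
proof
  fix e assume e: "e \<in> arcs G"
  have *: "\<exists>x\<in>A. c x = b" if A: "card A = 2" "inj_on c A" for A b
  proof -
    obtain x y where xy: "A = {x, y}" "y \<noteq> x" using A(1) by (auto simp: card_2_iff)
    then have "c y = (\<not> c x)" using A(2) by (simp add: inj_on_pair_bool)
    then show ?thesis using xy(1) by (cases "c x"; cases b) auto
  qed
  have "\<exists>P T. P @ [e] @ T \<in> routes G \<and> (\<forall>x\<in>set P \<union> set T. c x = c e)"
    using c e unfolding proper_colouring_iff
    by (intro awalk_extends_to_route[OF _ _ arc_implies_awalk] * card_in_arcs card_out_arcs) auto
  then obtain P T where PT: "P @ [e] @ T \<in> routes G" "\<forall>x\<in>set P \<union> set T. c x = c e" by blast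
  then have "P @ [e] @ T \<in> exceptional_routes G (colour_framing G c)"
    by (intro monochromatic_route_exceptional[where b = "c e"]) auto
  then show "\<exists>R\<in>exceptional_routes G (colour_framing G c). e \<in> set R"
    by (rule bexI[rotated]) simp
qed

text \<open>An edge has a label \<open>hc\<close> from the order at its head and \<open>tc\<close>
  from the order at its tail. An exceptional route through the edge forces them to agree when both
  ends are inner, so they merge into one colouring.\<close>

lemma ample_imp_colour_framing:
  assumes F: "F \<in> framings G" and ample: "ample G F"
  shows "\<exists>c. proper_colouring G c \<and> colour_framing G c = F"
proof -
  define hc where "hc e = above_another (fst F (head G e)) e" for e
  define tc where "tc e = above_another (snd F (tail G e)) e" for e
  have lin: "linear_order_on (in_arcs G v) (fst F v)" "linear_order_on (out_arcs G v) (snd F v)"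
    if "v \<in> inner_verts G" for v
    using F that by (auto simp: framings_def)
  have fst_F: "inj_on hc (in_arcs G v)" "order_by hc (in_arcs G v) = fst F v" if v: "v \<in> inner_verts G" for v
  proof -
    have eq: "above_another (fst F v) x = hc x" if "x \<in> in_arcs G v" for x using that by (auto simp: hc_def)
    show "inj_on hc (in_arcs G v)" "order_by hc (in_arcs G v) = fst F v"
      using linear_order_on_card_2[OF card_in_arcs[OF v] lin(1)[OF v]]
        inj_on_cong[of "in_arcs G v", OF eq] order_by_cong[of "in_arcs G v", OF eq] by simp_all
  qed
  have snd_F: "inj_on tc (out_arcs G v)" "order_by tc (out_arcs G v) = snd F v" if v: "v \<in> inner_verts G" for v
  proof -
    have eq: "above_another (snd F v) x = tc x" if "x \<in> out_arcs G v" for x using that by (auto simp: tc_def)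
    show "inj_on tc (out_arcs G v)" "order_by tc (out_arcs G v) = snd F v"
      using linear_order_on_card_2[OF card_out_arcs[OF v] lin(2)[OF v]]
        inj_on_cong[of "out_arcs G v", OF eq] order_by_cong[of "out_arcs G v", OF eq] by simp_all
  qed
  \<comment> \<open>If the labels differed, the detour through \<open>d'\<close> and
    \<open>g'\<close> would conflict with the route.\<close>
  have same: "hc d = tc g" if R: "P @ d # S @ g # T \<in> exceptional_routes G F" for P d S g T
  proof -
    obtain a b where ab: "awalk a (P @ d # S @ g # T) b"
      using R by (auto simp: exceptional_routes_def routes_def)
    have d: "head G d \<in> inner_verts G" "d \<in> arcs G"
      using head_inner_of_awalk[OF ab] ab by (auto simp: awalk_simps)
    have g: "tail G g \<in> inner_verts G" "g \<in> arcs G"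
      using tail_inner_of_awalk[of a "P @ d # S" g T b] ab by (auto simp: awalk_simps)
    obtain d' where d': "in_arcs G (head G d) = {d, d'}" "d' \<noteq> d"
      using card_2_other[OF card_in_arcs[OF d(1)], of d] d(2) by auto
    obtain g' where g': "out_arcs G (tail G g) = {g, g'}" "g' \<noteq> g"
      using card_2_other[OF card_out_arcs[OF g(1)], of g] g(2) by auto
    have D: "hc d' = (\<not> hc d)" using fst_F(1)[OF d(1)] d' by (simp add: inj_on_pair_bool)
    have E: "tc g' = (\<not> tc g)" using snd_F(1)[OF g(1)] g' by (simp add: inj_on_pair_bool)
    have "d' \<in> in_arcs G (head G d)" "g' \<in> out_arcs G (tail G g)" using d' g' by auto
    from exceptional_no_crossing[OF R this(1) d'(2) this(2) g'(2)] show ?thesis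
      unfolding fst_F(2)[OF d(1), symmetric] snd_F(2)[OF g(1), symmetric] order_by_def d'(1) g'(1)
      using d'(2) g'(2) by (cases "hc d"; cases "tc g") (auto simp: D E)
  qed
  have inner_eq: "hc e = tc e"
    if e: "e \<in> arcs G" "head G e \<in> inner_verts G" "tail G e \<in> inner_verts G" for e
  proof -
    obtain R where R: "R \<in> exceptional_routes G F" "e \<in> set R" using ample e(1) unfolding ample_iff by blast
    then obtain P T where PT: "R = P @ e # T" by (meson split_list)
    obtain u w where uw: "u \<in> sources G" "w \<in> sinks G" "awalk u (P @ e # T) w"
      using R(1) by (auto simp: PT exceptional_routes_def routes_def)
    have "P \<noteq> []" using uw e(3) by (auto simp: awalk_simps inner_verts_def)
    then obtain P' d where P: "P = P' @ [d]" by (cases P rule: rev_cases) auto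
    have "T \<noteq> []" using uw e(2) by (auto simp: awalk_simps inner_verts_def)
    then obtain g T' where T: "T = g # T'" by (cases T) auto
    \<comment> \<open>With \<open>d\<close> preceding and \<open>g\<close> following
      \<open>e\<close> on the route, the chain is \<open>tc e = hc d = tc g = hc e\<close>.\<close>
    have "hc d = tc e" using same[of P' d "[]" e T] R(1) by (simp add: PT P)
    moreover have "hc d = tc g" using same[of P' d "[e]" g T'] R(1) by (simp add: PT P T)
    moreover have "hc e = tc g" using same[of P e "[]" g T'] R(1) by (simp add: PT T)
    ultimately show ?thesis by simp
  qed
  \<comment> \<open>The tail label serves edges ending in a sink. On an edge from a source to a sink
    the value does not affect the framing.\<close>
  define c where "c e = (if head G e \<in> inner_verts G then hc e else tc e)" for e
  have ch: "hc x = c x" if "v \<in> inner_verts G" "x \<in> in_arcs G v" for v x using that by (auto simp: c_def)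
  have ct: "tc x = c x" if "v \<in> inner_verts G" "x \<in> out_arcs G v" for v x
    using that inner_eq[of x] by (auto simp: c_def)
  have "inj_on c (in_arcs G v)" "inj_on c (out_arcs G v)" if "v \<in> inner_verts G" for v
    using fst_F(1)[OF that] snd_F(1)[OF that] inj_on_cong[of "in_arcs G v", OF ch[OF that]]
      inj_on_cong[of "out_arcs G v", OF ct[OF that]] by simp_all
  then have "proper_colouring G c" by (simp add: proper_colouring_iff)
  moreover have "colour_framing G c = F"
  proof (rule prod_eqI; rule ext)
    fix v
    show "fst (colour_framing G c) v = fst F v"
      using fst_F(2)[of v] order_by_cong[of "in_arcs G v", OF ch[of v]] F
      by (cases "v \<in> inner_verts G") (auto simp: colour_framing_def framings_def)
    show "snd (colour_framing G c) v = snd F v"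
      using snd_F(2)[of v] order_by_cong[of "out_arcs G v", OF ct[of v]] F
      by (cases "v \<in> inner_verts G") (auto simp: colour_framing_def framings_def)
  qed
  ultimately show ?thesis by blast
qed

section \<open>Counting the framings induced by proper colourings\<close>

definition inner_arcs :: "'e set" where
  "inner_arcs = {e \<in> arcs G. tail G e \<in> inner_verts G \<or> head G e \<in> inner_verts G}"

text \<open>The colour of an edge with an inner end can be read off from the order at that end;
  other edges enter no order. This is why only strands meeting inner vertices are counted.\<close>

lemma colour_framing_eq_iff:
  assumes c: "proper_colouring G c" and d: "proper_colouring G d"
  shows "colour_framing G c = colour_framing G d \<longleftrightarrow> (\<forall>e\<in>inner_arcs. c e = d e)"
proof
  assume "\<forall>e\<in>inner_arcs. c e = d e"
  then have "order_by c (in_arcs G v) = order_by d (in_arcs G v)"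
    "order_by c (out_arcs G v) = order_by d (out_arcs G v)" if "v \<in> inner_verts G" for v
    using that by (auto intro!: order_by_cong simp: inner_arcs_def)
  then show "colour_framing G c = colour_framing G d" by (auto simp: colour_framing_def fun_eq_iff)
next
  assume eq: "colour_framing G c = colour_framing G d"
  show "\<forall>e\<in>inner_arcs. c e = d e"
  proof
    fix e assume e: "e \<in> inner_arcs"
    have *: "order_by c (in_arcs G v) = order_by d (in_arcs G v)"
      "order_by c (out_arcs G v) = order_by d (out_arcs G v)" if "v \<in> inner_verts G" for v
      using fun_cong[OF arg_cong[OF eq, of fst], of v] fun_cong[OF arg_cong[OF eq, of snd], of v] that
      by (simp_all add: colour_framing_def)
    from e consider "tail G e \<in> inner_verts G" | "head G e \<in> inner_verts G" and "e \<in> arcs G"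
      by (auto simp: inner_arcs_def)
    then show "c e = d e"
    proof cases
      case 1
      have "inj_on c (out_arcs G (tail G e))" "inj_on d (out_arcs G (tail G e))"
        using c d 1 by (simp_all add: proper_colouring_iff)
      moreover have "e \<in> out_arcs G (tail G e)" using e by (simp add: inner_arcs_def)
      ultimately show ?thesis
        using above_another_order_by[OF card_out_arcs[OF 1]] *(2)[OF 1] by metis
    next
      case 2
      have "inj_on c (in_arcs G (head G e))" "inj_on d (in_arcs G (head G e))"
        using c d 2 by (simp_all add: proper_colouring_iff)
      moreover have "e \<in> in_arcs G (head G e)" using 2 by simp
      ultimately show ?thesis
        using above_another_order_by[OF card_in_arcs[OF 2(1)]] *(1)[OF 2(1)] by metis
    qed
  qed
qed

text \<open>Exchanging partners at the head and at the tail gives involutions \<open>h\<close> and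
  \<open>t\<close> of the edges, fixing an edge whose respective end is not inner. Every link is a
  pair exchanged by one of them.\<close>

lemma ex_proper_colouring: "\<exists>c. proper_colouring G c"
proof -
  define oth where "oth A x = (THE y. y \<in> A \<and> y \<noteq> x)" for A and x :: 'e
  have oth: "oth {x, y} x = y" if "y \<noteq> x" for x y
    unfolding oth_def using that by (intro the_equality) auto
  have oth2: "oth A x \<in> A \<and> oth A (oth A x) = x" if "card A = 2" "x \<in> A" for A x
    using card_2_other[OF that] oth by (metis insert_commute insertI1)
  define h where "h e = (if head G e \<in> inner_verts G then oth (in_arcs G (head G e)) e else e)" for e
  define t where "t e = (if tail G e \<in> inner_verts G then oth (out_arcs G (tail G e)) e else e)" for e
  have h: "h e \<in> arcs G \<and> h (h e) = e" if "e \<in> arcs G" for e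
    using oth2[OF card_in_arcs, of "head G e" e] that by (auto simp: h_def)
  have t: "t e \<in> arcs G \<and> t (t e) = e" if "e \<in> arcs G" for e
    using oth2[OF card_out_arcs, of "tail G e" e] that by (auto simp: t_def)
  have "\<exists>c :: 'e \<Rightarrow> bool. \<forall>x\<in>arcs G.
      (h x \<noteq> x \<longrightarrow> c (h x) \<noteq> c x) \<and> (t x \<noteq> x \<longrightarrow> c (t x) \<noteq> c x)"
    using h t by (intro two_involutions_colouring finite_arcs) simp_all
  then obtain c :: "'e \<Rightarrow> bool" where c: "\<forall>x\<in>arcs G.
      (h x \<noteq> x \<longrightarrow> c (h x) \<noteq> c x) \<and> (t x \<noteq> x \<longrightarrow> c (t x) \<noteq> c x)" ..
  have "c e \<noteq> c f" if "(e, f) \<in> linked G" for e f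
  proof -
    obtain v where v: "e \<noteq> f" "v \<in> inner_verts G" "{e, f} = in_arcs G v \<or> {e, f} = out_arcs G v"
      using \<open>(e, f) \<in> linked G\<close> by (auto simp: linked_def)
    from v(3) show ?thesis
    proof
      assume A: "{e, f} = in_arcs G v"
      have "e \<in> in_arcs G v" unfolding A[symmetric] by simp
      then have e: "e \<in> arcs G" "head G e = v" by simp_all
      then have "h e = f" using v oth[of f e] by (simp add: h_def A[symmetric])
      then show ?thesis using bspec[OF c e(1)] v(1) by metis
    next
      assume A: "{e, f} = out_arcs G v"
      have "e \<in> out_arcs G v" unfolding A[symmetric] by simp
      then have e: "e \<in> arcs G" "tail G e = v" by simp_all
      then have "t e = f" using v oth[of f e] by (simp add: t_def A[symmetric])
      then show ?thesis using bspec[OF c e(1)] v(1) by metis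
    qed
  qed
  then show ?thesis unfolding proper_colouring_def by blast
qed

text \<open>Relative to a fixed proper colouring \<open>c0\<close>, every other one arises by
  flipping whole strands. Only flips of strands in \<open>I\<close> change the framing, so subsets
  of \<open>I\<close> correspond bijectively to ample framings.\<close>

lemma card_ample_framings: "card {F \<in> framings G. ample G F} = 2 ^ num_inner_strands G"
proof -
  obtain c0 where c0: "proper_colouring G c0" using ex_proper_colouring by blast
  define strand where "strand e = (linked G)\<^sup>* `` {e}" for e
  have "sym ((linked G)\<^sup>*)"
    by (intro sym_rtrancl symI) (auto simp: linked_def insert_commute)
  then have equiv: "equiv UNIV ((linked G)\<^sup>*)"
    by (intro equivI refl_rtrancl trans_rtrancl) auto
  have strand_eq: "strand e = strand f \<longleftrightarrow> (e, f) \<in> (linked G)\<^sup>*" for e f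
    unfolding strand_def using eq_equiv_class_iff[OF equiv] by simp
  have strand_sub: "f \<in> arcs G" if "f \<in> strand e" "e \<in> arcs G" for e f
  proof -
    have "(e, f) \<in> (linked G)\<^sup>*" using that by (simp add: strand_def)
    then show ?thesis using that(2)
      by induction (auto simp: linked_def in_arcs_def out_arcs_def)
  qed
  define I where "I = {S \<in> strands G. \<exists>e \<in> S. tail G e \<in> inner_verts G \<or> head G e \<in> inner_verts G}"
  have I: "I = strand ` inner_arcs"
  proof (intro set_eqI iffI)
    fix S assume "S \<in> I"
    then obtain e f where ef: "e \<in> arcs G" "S = strand e" "f \<in> S"
      "tail G f \<in> inner_verts G \<or> head G f \<in> inner_verts G"
      by (auto simp: I_def strands_def quotient_def strand_def)
    then have "f \<in> arcs G" using strand_sub by blast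
    moreover have "S = strand f" using ef strand_eq by (simp add: strand_def)
    ultimately show "S \<in> strand ` inner_arcs" using ef(4) by (auto simp: inner_arcs_def)
  next
    fix S assume "S \<in> strand ` inner_arcs"
    then show "S \<in> I" by (auto simp: I_def strands_def quotient_def strand_def inner_arcs_def)
  qed
  define col where "col X e = (c0 e \<noteq> (strand e \<in> X))" for X e
  have col: "proper_colouring G (col X)" for X
  proof -
    have "col X e \<noteq> col X f" if "(e, f) \<in> linked G" for e f
    proof -
      have "strand e = strand f" using that by (simp add: strand_eq r_into_rtrancl)
      moreover have "c0 e \<noteq> c0 f" using c0 that unfolding proper_colouring_def by blast
      ultimately show ?thesis unfolding col_def by metis
    qed
    then show ?thesis unfolding proper_colouring_def by blast
  qed
  \<comment> \<open>Each strand in \<open>I\<close> contains an edge of \<open>inner_arcs\<close>,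
    whose colour under \<open>col X\<close> reveals whether the strand is in
    \<open>X\<close>.\<close>
  have "inj_on (\<lambda>X. colour_framing G (col X)) (Pow I)"
    unfolding inj_on_def colour_framing_eq_iff[OF col col] I by (auto simp: col_def)
  moreover have "(\<lambda>X. colour_framing G (col X)) ` Pow I = {F \<in> framings G. ample G F}"
  proof (intro set_eqI iffI)
    fix F assume "F \<in> (\<lambda>X. colour_framing G (col X)) ` Pow I"
    then show "F \<in> {F \<in> framings G. ample G F}"
      using colour_framing_in_framings[OF col] ample_colour_framing[OF col] by auto
  next
    fix F assume "F \<in> {F \<in> framings G. ample G F}"
    then obtain c where c: "proper_colouring G c" "colour_framing G c = F"
      using ample_imp_colour_framing by blast
    \<comment> \<open>Both colourings change along every link, so whether they disagree is constant
      on a strand.\<close>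
    have const: "(c e \<noteq> c0 e) = (c f \<noteq> c0 f)" if "(e, f) \<in> (linked G)\<^sup>*" for e f
      using that
    proof induction
      case (step f g)
      then have "c f \<noteq> c g" "c0 f \<noteq> c0 g"
        using c(1) c0 unfolding proper_colouring_def by blast+
      then show ?case using step.IH by blast
    qed simp
    \<comment> \<open>These are the strands on which \<open>c0\<close> must be flipped to become
      \<open>c\<close>.\<close>
    define X where "X = strand ` {e \<in> inner_arcs. c e \<noteq> c0 e}"
    have "X \<in> Pow I" by (auto simp: X_def I)
    moreover have "\<forall>e\<in>inner_arcs. col X e = c e"
    proof
      fix e assume e: "e \<in> inner_arcs"
      have "strand e \<in> X \<longleftrightarrow> c e \<noteq> c0 e"
        using e const unfolding X_def image_iff strand_eq by blast
      then show "col X e = c e" unfolding col_def by blast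
    qed
    then have "colour_framing G (col X) = F"
      using colour_framing_eq_iff[OF col c(1)] c(2) by blast
    ultimately show "F \<in> (\<lambda>X. colour_framing G (col X)) ` Pow I" by blast
  qed
  ultimately have "card {F \<in> framings G. ample G F} = card (Pow I)"
    using card_image by metis
  also have "\<dots> = 2 ^ card I"
    by (rule card_Pow) (simp add: I)
  finally show ?thesis by (simp add: I_def num_inner_strands_def)
qed

end

theorem theorem4p1:
  fixes G :: "('v, 'e::finite) pre_digraph"
  assumes "full_dag G"
  shows "card {F \<in> framings G. ample G F} = 2 ^ num_inner_strands G"
proof -
  interpret fin_digraph G using assms by (simp add: full_dag_def dag_def)
  interpret full_dag_graph G
    by unfold_locales
      (use assms in \<open>auto simp: full_dag_def dag_def in_degree_def out_degree_def\<close>)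
  show ?thesis by (rule card_ample_framings)
qed

end
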